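(* Let $k$ be an algebraically closed field of characteristic zero and let $q\in k$ be non-zero and not a root of unity. For every $\ell\in\frac12\mathbb{N}_0$, the Frobenius--Schur indicator of the left $U_q(\mathfrak{sl}_2)$-module $V_\ell$ (with respect to the pivotal element $K$) is $$\nu(V_\ell)=(-1)^{2\ell}.$$
   Context: $\mathbb{N}_0=\{0,1,2,\dots\}$ and $[n]_q=\frac{q^n-q^{-n}}{q-q^{-1}}$. $U_q(\mathfrak{sl}_2)$ is the Hopf algebra generated as an algebra by $E,F,K,K^{-1}$ with relations $KK^{-1}=1=K^{-1}K$, $KEK^{-1}=q^2E$, $KFK^{-1}=q^{-2}F$, $EF-FE=\frac{K-K^{-1}}{q-q^{-1}}$; $\Delta(K)=K\otimes K$, $\Delta(E)=E\otimes K+1\otimes E$, $\Delta(F)=F\otimes1+K^{-1}\otimes F$; $\varepsilon(K)=1$, $\varepsilon(E)=\varepsilon(F)=0$; $S(K)=K^{-1}$, $S(E)=-EK^{-1}$, $S(F)=-KF$. One has $S^2(u)=KuK^{-1}$ for all $u$. For $\ell\in\frac12\mathbb{N}_0$ let $I_\ell=\{-\ell,-\ell+1,\dots,\ell\}$. The left module $V_\ell$ has basis $\{v_i\}_{i\in I_\ell}$ with action $Kv_i=q^{2i}v_i$, $Ev_i=[\ell+i+1]_qv_{i+1}$, $Fv_i=[\ell-i+1]_qv_{i-1}$, where $v_{\ell+1}=v_{-(\ell+1)}=0$. For a finite-dimensional left module $V$ over $U=U_q(\mathfrak{sl}_2)$, the dual space $V^\vee$ is a left module by $\langle uf,v\rangle=\langle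 f,S(u)v\rangle$, and $j_V:V\to V^{\vee\vee}$, $\langle j_V(v),f\rangle=\langle f,Kv\rangle$, is an isomorphism of modules. The Frobenius--Schur indicator $\nu(V)\in k$ is the trace of the linear map $\mathrm{Hom}_U(V,V^\vee)\to\mathrm{Hom}_U(V,V^\vee)$, $f\mapsto f^\vee\circ j_V$, where $f^\vee$ is the transpose of $f$. *)

theory Defs
  imports
    "HOL-Algebra.QuotRing"
    "HOL-Algebra.Algebraic_Closure_Type"
    "HOL-Library.Poly_Mapping"
    "HOL-Library.Function_Algebras"
begin

section \<open>The free algebra on the generators\<close>

text \<open>\<open>GKi\<close> stands for the generator $K^{-1}$.\<close>

datatype uq_gen = GE | GF | GK | GKi

text \<open>Words are wrapped in a datatype so that concatenation can be the addition of a
  \<open>monoid_add\<close> instance; \<open>uq_word \<Rightarrow>\<^sub>0 'k\<close> is then the free associative unital algebra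
  on the four generators, with the convolution product of \<open>Poly_Mapping\<close>.\<close>

datatype uq_word = Word (letters: "uq_gen list")

instantiation uq_word :: monoid_add
begin
definition "0 = Word []"
definition "a + b = Word (letters a @ letters b)"
instance
  by standard (simp_all add: zero_uq_word_def plus_uq_word_def)
end

type_synonym 'k free_alg = "uq_word \<Rightarrow>\<^sub>0 'k"

definition free_gen :: "uq_gen \<Rightarrow> 'k::field free_alg" where
  "free_gen g = Poly_Mapping.single (Word [g]) 1"

definition free_const :: "'k \<Rightarrow> 'k::field free_alg" where
  "free_const c = Poly_Mapping.single 0 c"


section \<open>The algebra \<open>U\<^sub>q(sl\<^sub>2)\<close> and its antipode\<close>

definition uq_relators :: "'k::field \<Rightarrow> 'k free_alg set" where
  "uq_relators q =
    (let E = free_gen GE; F = free_gen GF; K = free_gen GK; Ki = free_gen GKi in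
      {K * Ki - 1,
       Ki * K - 1,
       K * E * Ki - free_const (q powi 2) * E,
       K * F * Ki - free_const (q powi (-2)) * F,
       E * F - F * E - free_const (1 / (q - inverse q)) * (K - Ki)})"

definition uq_ideal :: "'k::field \<Rightarrow> 'k free_alg set" where
  "uq_ideal q = Idl\<^bsub>ring_of_type_algebra\<^esub> (uq_relators q)"

definition Uq :: "'k::field \<Rightarrow> 'k free_alg set ring" where
  "Uq q = ring_of_type_algebra Quot (uq_ideal q)"

definition uq_class :: "'k::field \<Rightarrow> 'k free_alg \<Rightarrow> 'k free_alg set" where
  "uq_class q p = uq_ideal q +>\<^bsub>ring_of_type_algebra\<^esub> p"

fun free_antipode_gen :: "uq_gen \<Rightarrow> 'k::field free_alg" where
  "free_antipode_gen GE = - (free_gen GE * free_gen GKi)"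
| "free_antipode_gen GF = - (free_gen GK * free_gen GF)"
| "free_antipode_gen GK = free_gen GKi"
| "free_antipode_gen GKi = free_gen GK"

text \<open>The antihomomorphism of the free algebra determined by the values on the generators.\<close>

definition free_antipode :: "'k::field free_alg \<Rightarrow> 'k free_alg" where
  "free_antipode p = (\<Sum>w\<in>Poly_Mapping.keys p. free_const (Poly_Mapping.lookup p w) *
     prod_list (rev (map free_antipode_gen (letters w))))"

text \<open>Independence of the representative is \<open>antipode_uq_class\<close> below.\<close>

definition antipode :: "'k::field \<Rightarrow> 'k free_alg set \<Rightarrow> 'k free_alg set" where
  "antipode q u = uq_class q (free_antipode (SOME p. p \<in> u))"


section \<open>Modules, duals, homomorphisms\<close>

text \<open>The underlying space of a module is a subspace of an ambient vector space, which is a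
  whole type.\<close>

record (overloaded) ('k::zero, 'v) uq_rep =
  rep_space :: "'v set"
  rep_scale :: "'k \<Rightarrow> 'v \<Rightarrow> 'v"
  rep_act :: "'k free_alg set \<Rightarrow> 'v \<Rightarrow> 'v"

locale uq_module = vector_space "rep_scale M"
  for q :: "'k::field" and M :: "('k, 'v::ab_group_add) uq_rep" +
  assumes subspace_space: "subspace (rep_space M)"
    and act_closed: "u \<in> carrier (Uq q) \<Longrightarrow> x \<in> rep_space M \<Longrightarrow> rep_act M u x \<in> rep_space M"
    and act_add_right: "u \<in> carrier (Uq q) \<Longrightarrow> x \<in> rep_space M \<Longrightarrow> y \<in> rep_space M \<Longrightarrow>
          rep_act M u (x + y) = rep_act M u x + rep_act M u y"
    and act_scale_right: "u \<in> carrier (Uq q) \<Longrightarrow> x \<in> rep_space M \<Longrightarrow>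
          rep_act M u (rep_scale M c x) = rep_scale M c (rep_act M u x)"
    and act_add_left: "u \<in> carrier (Uq q) \<Longrightarrow> w \<in> carrier (Uq q) \<Longrightarrow> x \<in> rep_space M \<Longrightarrow>
          rep_act M (u \<oplus>\<^bsub>Uq q\<^esub> w) x = rep_act M u x + rep_act M w x"
    and act_mult: "u \<in> carrier (Uq q) \<Longrightarrow> w \<in> carrier (Uq q) \<Longrightarrow> x \<in> rep_space M \<Longrightarrow>
          rep_act M (u \<otimes>\<^bsub>Uq q\<^esub> w) x = rep_act M u (rep_act M w x)"
    and act_const: "x \<in> rep_space M \<Longrightarrow>
          rep_act M (uq_class q (free_const c)) x = rep_scale M c x"

locale fd_uq_module = uq_module +
  assumes finite_dim: "\<exists>B. finite B \<and> span B = rep_space M"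

text \<open>Maps defined on a subset are extended by zero, so that maps on a subspace form a vector
  space with the pointwise operations of the function type.\<close>

definition restrict0 :: "'a set \<Rightarrow> ('a \<Rightarrow> 'b::zero) \<Rightarrow> 'a \<Rightarrow> 'b" where
  "restrict0 A f = (\<lambda>x. if x \<in> A then f x else 0)"

definition fun_scale :: "('k \<Rightarrow> 'b \<Rightarrow> 'b) \<Rightarrow> 'k \<Rightarrow> ('a \<Rightarrow> 'b) \<Rightarrow> 'a \<Rightarrow> 'b" where
  "fun_scale s c f = (\<lambda>x. s c (f x))"

definition linear_maps ::
    "'a::ab_group_add set \<Rightarrow> ('k \<Rightarrow> 'a \<Rightarrow> 'a) \<Rightarrow> 'b::ab_group_add set \<Rightarrow> ('k \<Rightarrow> 'b \<Rightarrow> 'b) \<Rightarrow>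
     ('a \<Rightarrow> 'b) set" where
  "linear_maps V s W t = {f. restrict0 V f = f \<and> f ` V \<subseteq> W \<and>
     (\<forall>x\<in>V. \<forall>y\<in>V. f (x + y) = f x + f y) \<and> (\<forall>c. \<forall>x\<in>V. f (s c x) = t c (f x))}"

definition dual_rep ::
    "'k::field \<Rightarrow> ('k, 'v::ab_group_add) uq_rep \<Rightarrow> ('k, 'v \<Rightarrow> 'k) uq_rep" where
  "dual_rep q M = \<lparr>
     rep_space = linear_maps (rep_space M) (rep_scale M) UNIV (*),
     rep_scale = fun_scale (*),
     rep_act = (\<lambda>u f. restrict0 (rep_space M) (\<lambda>v. f (rep_act M (antipode q u) v)))\<rparr>"

definition uq_hom ::
    "'k::field \<Rightarrow> ('k, 'v::ab_group_add) uq_rep \<Rightarrow> ('k, 'w::ab_group_add) uq_rep \<Rightarrow>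
     ('v \<Rightarrow> 'w) set" where
  "uq_hom q M N = {f \<in> linear_maps (rep_space M) (rep_scale M) (rep_space N) (rep_scale N).
     \<forall>u\<in>carrier (Uq q). \<forall>x\<in>rep_space M. f (rep_act M u x) = rep_act N u (f x)}"

text \<open>The transpose $W^\vee \to V^\vee$ of a linear map $V \to W$.\<close>

definition transpose_map ::
    "('k::field, 'v::ab_group_add) uq_rep \<Rightarrow> ('v \<Rightarrow> 'w) \<Rightarrow> ('w \<Rightarrow> 'k) \<Rightarrow> 'v \<Rightarrow> 'k" where
  "transpose_map M f g = restrict0 (rep_space M) (g \<circ> f)"

definition pivotal_map ::
    "'k::field \<Rightarrow> ('k, 'v::ab_group_add) uq_rep \<Rightarrow> 'v \<Rightarrow> ('v \<Rightarrow> 'k) \<Rightarrow> 'k" where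
  "pivotal_map q M v = restrict0 (rep_space (dual_rep q M))
     (\<lambda>f. f (rep_act M (uq_class q (free_gen GK)) v))"


section \<open>The Frobenius--Schur indicator\<close>

text \<open>The trace of an endomorphism \<open>T\<close> of a finite-dimensional subspace \<open>H\<close>; it does not
  depend on the basis by \<open>trace_on_eq\<close> below.\<close>

definition (in vector_space) trace_on :: "'b set \<Rightarrow> ('b \<Rightarrow> 'b) \<Rightarrow> 'a" where
  "trace_on H T = (let B = (SOME B. independent B \<and> span B = H)
     in \<Sum>b\<in>B. representation B (T b) b)"

definition fs_indicator :: "'k::field \<Rightarrow> ('k, 'v::ab_group_add) uq_rep \<Rightarrow> 'k" where
  "fs_indicator q M =
     vector_space.trace_on (fun_scale (rep_scale (dual_rep q M)))
       (uq_hom q M (dual_rep q M))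
       (\<lambda>f. restrict0 (rep_space M) (transpose_map M f \<circ> pivotal_map q M))"


section \<open>The modules \<open>V\<^sub>\<ell>\<close>\<close>

definition q_int :: "'k::field \<Rightarrow> int \<Rightarrow> 'k" where
  "q_int q n = (q powi n - q powi (- n)) / (q - inverse q)"

definition I_set :: "rat \<Rightarrow> rat set" where
  "I_set l = {i. (\<exists>n::nat. i = - l + of_nat n) \<and> i \<le> l}"

text \<open>\<open>v_basis l i\<close> is zero for \<open>i\<close> outside \<open>I_set l\<close>, in particular for \<open>i = l + 1\<close> and
  \<open>i = - (l + 1)\<close>.\<close>

definition v_basis :: "rat \<Rightarrow> rat \<Rightarrow> rat \<Rightarrow> 'k::field" where
  "v_basis l i = (\<lambda>j. if j = i \<and> i \<in> I_set l then 1 else 0)"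

text \<open>The floors are taken of integers whenever \<open>2 * l\<close> is a natural number and
  \<open>i \<in> I_set l\<close>.\<close>

fun v_gen_basis :: "'k::field \<Rightarrow> rat \<Rightarrow> uq_gen \<Rightarrow> rat \<Rightarrow> rat \<Rightarrow> 'k" where
  "v_gen_basis q l GK i = fun_scale (*) (q powi \<lfloor>2 * i\<rfloor>) (v_basis l i)"
| "v_gen_basis q l GKi i = fun_scale (*) (q powi (- \<lfloor>2 * i\<rfloor>)) (v_basis l i)"
| "v_gen_basis q l GE i = fun_scale (*) (q_int q \<lfloor>l + i + 1\<rfloor>) (v_basis l (i + 1))"
| "v_gen_basis q l GF i = fun_scale (*) (q_int q \<lfloor>l - i + 1\<rfloor>) (v_basis l (i - 1))"

definition v_gen :: "'k::field \<Rightarrow> rat \<Rightarrow> uq_gen \<Rightarrow> (rat \<Rightarrow> 'k) \<Rightarrow> rat \<Rightarrow> 'k" where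
  "v_gen q l g x = (\<Sum>i\<in>I_set l. fun_scale (*) (x i) (v_gen_basis q l g i))"

definition v_free_act :: "'k::field \<Rightarrow> rat \<Rightarrow> 'k free_alg \<Rightarrow> (rat \<Rightarrow> 'k) \<Rightarrow> rat \<Rightarrow> 'k" where
  "v_free_act q l p x = (\<Sum>w\<in>Poly_Mapping.keys p.
     fun_scale (*) (Poly_Mapping.lookup p w) (foldr (v_gen q l) (letters w) x))"

text \<open>Independence of the representative is \<open>v_rep_act_uq_class\<close> below.\<close>

definition v_rep :: "'k::field \<Rightarrow> rat \<Rightarrow> ('k, rat \<Rightarrow> 'k) uq_rep" where
  "v_rep q l = \<lparr>
     rep_space = {x. \<forall>i. i \<notin> I_set l \<longrightarrow> x i = 0},
     rep_scale = fun_scale (*),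
     rep_act = (\<lambda>u. v_free_act q l (SOME p. p \<in> u))\<rparr>"


section \<open>Well-definedness\<close>

lemma ring_of_free_alg: "ring (ring_of_type_algebra :: 'k::field free_alg ring)"
proof -
  have "\<exists>y. x + y = 0" for x :: "'k free_alg"
    using add.right_inverse by blast
  then show ?thesis
    unfolding ring_of_type_algebra_def using add.right_inverse
    by unfold_locales (auto simp: algebra_simps Units_def)
qed

lemma ideal_uq_ideal: "ideal (uq_ideal q) ring_of_type_algebra"
  unfolding uq_ideal_def
  by (rule ring.genideal_ideal[OF ring_of_free_alg]) (simp add: ring_of_type_algebra_def)

lemma relator_in_uq_ideal: "r \<in> uq_relators q \<Longrightarrow> r \<in> uq_ideal q"
  unfolding uq_ideal_def
  using ring.genideal_self[OF ring_of_free_alg, of "uq_relators q"]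
  by (auto simp: ring_of_type_algebra_def)

lemma uq_ideal_zero: "0 \<in> uq_ideal q"
  using additive_subgroup.zero_closed[OF ideal.axioms(1)[OF ideal_uq_ideal[of q]]]
  by (simp add: ring_of_type_algebra_def)

lemma uq_ideal_add: "a \<in> uq_ideal q \<Longrightarrow> b \<in> uq_ideal q \<Longrightarrow> a + b \<in> uq_ideal q"
  using additive_subgroup.a_closed[OF ideal.axioms(1)[OF ideal_uq_ideal[of q]], of a b]
  by (simp add: ring_of_type_algebra_def)

lemma uq_ideal_mult_left: "a \<in> uq_ideal q \<Longrightarrow> p * a \<in> uq_ideal q"
  using ideal.I_l_closed[OF ideal_uq_ideal[of q], of a p]
  by (simp add: ring_of_type_algebra_def)

lemma uq_ideal_mult_right: "a \<in> uq_ideal q \<Longrightarrow> a * p \<in> uq_ideal q"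
  using ideal.I_r_closed[OF ideal_uq_ideal[of q], of a p]
  by (simp add: ring_of_type_algebra_def)

lemma uq_ideal_uminus: "a \<in> uq_ideal q \<Longrightarrow> - a \<in> uq_ideal q"
  using uq_ideal_mult_left[of a q "-1"] by simp

lemma uq_ideal_diff: "a \<in> uq_ideal q \<Longrightarrow> b \<in> uq_ideal q \<Longrightarrow> a - b \<in> uq_ideal q"
  using uq_ideal_add[of a q "- b"] uq_ideal_uminus[of b q] by simp

lemma uq_ideal_least:
  assumes "uq_relators q \<subseteq> J" "0 \<in> J" "\<And>a b. a \<in> J \<Longrightarrow> b \<in> J \<Longrightarrow> a + b \<in> J"
    and l: "\<And>a p. a \<in> J \<Longrightarrow> p * a \<in> J" and r: "\<And>a p. a \<in> J \<Longrightarrow> a * p \<in> J"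
  shows "uq_ideal q \<subseteq> J"
proof -
  have neg: "- a \<in> J" if "a \<in> J" for a
    using l[OF that, of "-1"] by simp
  have inv: "inv\<^bsub>add_monoid ring_of_type_algebra\<^esub> a = - a" for a :: "'a free_alg"
    unfolding m_inv_def
    by (rule the_equality) (auto simp: ring_of_type_algebra_def eq_neg_iff_add_eq_0)
  have "ideal J ring_of_type_algebra"
    by (rule idealI[OF ring_of_free_alg], rule subgroup.intro)
       (use assms neg inv in \<open>auto simp: ring_of_type_algebra_def\<close>)
  then show ?thesis
    unfolding uq_ideal_def
    by (rule ring.genideal_minimal[OF ring_of_free_alg]) (fact assms(1))
qed

lemma uq_class_eq: "uq_class q p = {p'. p' - p \<in> uq_ideal q}"
  by (force simp: uq_class_def a_r_coset_def r_coset_def ring_of_type_algebra_def)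

lemma uq_class_eq_iff: "uq_class q p = uq_class q p' \<longleftrightarrow> p - p' \<in> uq_ideal q"
proof
  assume "uq_class q p = uq_class q p'"
  moreover have "p \<in> uq_class q p" by (simp add: uq_class_eq uq_ideal_zero)
  ultimately show "p - p' \<in> uq_ideal q" by (simp add: uq_class_eq)
next
  assume *: "p - p' \<in> uq_ideal q"
  show "uq_class q p = uq_class q p'"
  proof (unfold uq_class_eq, intro Collect_cong iffI)
    fix x
    show "x - p' \<in> uq_ideal q" if "x - p \<in> uq_ideal q"
      using uq_ideal_add[OF that *] by simp
    show "x - p \<in> uq_ideal q" if "x - p' \<in> uq_ideal q"
      using uq_ideal_diff[OF that *] by simp
  qed
qed

lemma some_in_uq_class: "(SOME p'. p' \<in> uq_class q p) - p \<in> uq_ideal q"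
proof -
  have "p \<in> uq_class q p" by (simp add: uq_class_eq uq_ideal_zero)
  then have "(SOME p'. p' \<in> uq_class q p) \<in> uq_class q p" by (rule someI)
  then show ?thesis by (simp add: uq_class_eq)
qed

lemma carrier_Uq: "carrier (Uq q) = range (uq_class q)"
  by (auto simp: Uq_def FactRing_def A_RCOSETS_def RCOSETS_def uq_class_def a_r_coset_def
      ring_of_type_algebra_def)

lemma Uq_mult_class: "uq_class q a \<otimes>\<^bsub>Uq q\<^esub> uq_class q b = uq_class q (a * b)"
  using ideal.rcoset_mult_add[OF ideal_uq_ideal[of q], of a b]
  by (simp add: Uq_def FactRing_def uq_class_def ring_of_type_algebra_def)

lemma Uq_add_class: "uq_class q a \<oplus>\<^bsub>Uq q\<^esub> uq_class q b = uq_class q (a + b)"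
  using ideal.a_rcos_sum[OF ideal_uq_ideal[of q], of a b]
  by (simp add: Uq_def FactRing_def uq_class_def ring_of_type_algebra_def)

lemma ring_Uq: "ring (Uq q)"
  unfolding Uq_def by (rule ideal.quotient_is_ring[OF ideal_uq_ideal])

lemma free_alg_induct [case_names single add]:
  assumes "\<And>w c. P (Poly_Mapping.single w c)" "\<And>p r. P p \<Longrightarrow> P r \<Longrightarrow> P (p + r)"
  shows "P (p :: 'k::field free_alg)"
proof (induction p rule: update_induct)
  case const
  show ?case using assms(1)[of undefined 0] by simp
next
  case (update p w c)
  have "Poly_Mapping.update w c p = p + Poly_Mapping.single w c"
    using update by (intro poly_mapping_eqI)
      (auto simp: lookup_update lookup_add lookup_single when_def in_keys_iff)
  then show ?case using assms update by simp
qed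

lemma sum_keys_add:
  fixes f :: "uq_word \<Rightarrow> 'k::field \<Rightarrow> 'b::comm_monoid_add"
  assumes "\<And>w. f w 0 = 0" "\<And>w a b. f w (a + b) = f w a + f w b"
  shows "(\<Sum>w\<in>Poly_Mapping.keys (p + r). f w (Poly_Mapping.lookup (p + r) w)) =
     (\<Sum>w\<in>Poly_Mapping.keys p. f w (Poly_Mapping.lookup p w)) +
     (\<Sum>w\<in>Poly_Mapping.keys r. f w (Poly_Mapping.lookup r w))"
proof -
  let ?A = "Poly_Mapping.keys p \<union> Poly_Mapping.keys r"
  have *: "(\<Sum>w\<in>Poly_Mapping.keys s. f w (Poly_Mapping.lookup s w)) =
      (\<Sum>w\<in>?A. f w (Poly_Mapping.lookup s w))" if "Poly_Mapping.keys s \<subseteq> ?A" for s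
    using that assms(1) by (intro sum.mono_neutral_left) (auto simp: in_keys_iff)
  show ?thesis
    unfolding *[OF keys_add] *[OF Un_upper1] *[OF Un_upper2]
    by (simp add: lookup_add assms(2) sum.distrib)
qed

lemma free_const_add: "free_const (a + b) = free_const a + free_const b"
  by (simp add: free_const_def single_add)

lemma free_const_0 [simp]: "free_const 0 = 0"
  by (simp add: free_const_def)

lemma free_const_1 [simp]: "free_const 1 = 1"
  by (simp add: free_const_def)

lemma free_const_mult: "free_const (a * b) = free_const a * free_const b"
  by (simp add: free_const_def mult_single)

lemma free_const_commute: "p * free_const c = free_const c * p"
  by (induction p rule: free_alg_induct)
     (simp_all add: free_const_def mult_single algebra_simps)

lemma free_antipode_single:
  "free_antipode (Poly_Mapping.single w c) =
     free_const c * prod_list (rev (map free_antipode_gen (letters w)))"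
  by (simp add: free_antipode_def)

lemma free_antipode_add: "free_antipode (p + r) = free_antipode p + free_antipode r"
  unfolding free_antipode_def
  by (rule sum_keys_add) (simp_all add: free_const_add algebra_simps)

lemma free_antipode_mult: "free_antipode (p * r) = free_antipode r * free_antipode p"
proof (induction p rule: free_alg_induct)
  case (single w c)
  show ?case
  proof (induction r rule: free_alg_induct)
    case (single w' c')
    show ?case
      by (simp add: mult_single free_antipode_single plus_uq_word_def free_const_mult mult.assoc)
         (metis free_const_commute mult.assoc)
  qed (simp add: free_antipode_add algebra_simps)
qed (simp add: free_antipode_add algebra_simps)

lemma free_antipode_const [simp]: "free_antipode (free_const c) = free_const c"
  by (simp add: free_antipode_single[of 0, folded free_const_def] zero_uq_word_def)

lemma free_antipode_0 [simp]: "free_antipode 0 = 0"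
  using free_antipode_const[of 0] by (simp del: free_antipode_const)

lemma free_antipode_1 [simp]: "free_antipode 1 = 1"
  using free_antipode_const[of 1] by (simp del: free_antipode_const)

lemma free_antipode_uminus: "free_antipode (- p) = - free_antipode p"
  using free_antipode_add[of p "-p"] by (simp add: eq_neg_iff_add_eq_0 add.commute)

lemma free_antipode_diff: "free_antipode (p - r) = free_antipode p - free_antipode r"
  using free_antipode_add[of p "- r"] by (simp add: free_antipode_uminus)

lemma free_antipode_free_gen [simp]: "free_antipode (free_gen g) = free_antipode_gen g"
  by (simp add: free_gen_def free_antipode_single)

lemma free_antipode_relator:
  assumes "q \<noteq> 0" "r \<in> uq_relators q"
  shows "free_antipode r \<in> uq_ideal q"
proof -
  define E F K L :: "'a free_alg" where defs: "E = free_gen GE" "F = free_gen GF"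
    "K = free_gen GK" "L = free_gen GKi"
  define c d e :: "'a free_alg" where cde: "c = free_const (q powi 2)" "d = free_const (q powi (-2))"
    "e = free_const (1 / (q - inverse q))"
  have com: "p * c = c * p" "p * d = d * p" "p * e = e * p" for p
    by (simp_all add: cde free_const_commute)
  have R: "K * L - 1 \<in> uq_ideal q" "L * K - 1 \<in> uq_ideal q"
     "K * E * L - c * E \<in> uq_ideal q" "K * F * L - d * F \<in> uq_ideal q"
     "E * F - F * E - e * (K - L) \<in> uq_ideal q"
    by (rule relator_in_uq_ideal, simp add: uq_relators_def Let_def defs cde)+
  have S: "free_antipode E = - (E * L)" "free_antipode F = - (K * F)"
     "free_antipode K = L" "free_antipode L = K"
     "free_antipode c = c" "free_antipode d = d" "free_antipode e = e"
    by (simp_all add: defs cde)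
  note simps = free_antipode_mult free_antipode_diff S
  consider "r = K * L - 1" | "r = L * K - 1" | "r = K * E * L - c * E" | "r = K * F * L - d * F"
    | "r = E * F - F * E - e * (K - L)"
    using assms by (auto simp: uq_relators_def Let_def defs cde)
  then show ?thesis
  proof cases
    case 1 then show ?thesis using R by (simp add: simps)
  next
    case 2 then show ?thesis using R by (simp add: simps)
  next
    case 3
    have "free_antipode r = - ((K * E * L - c * E) * L)"
      unfolding 3 simps com by (simp add: algebra_simps com)
    then show ?thesis using R by (metis uq_ideal_uminus uq_ideal_mult_right)
  next
    case 4
    have "free_antipode r = - (K * (K * F * L - d * F))"
      unfolding 4 simps com by (simp add: algebra_simps) (metis com(2) mult.assoc)
    then show ?thesis using R by (metis uq_ideal_uminus uq_ideal_mult_left)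
  next
    case 5
    have "d * c = 1"
      using \<open>q \<noteq> 0\<close> by (simp add: cde free_const_mult[symmetric] power_int_minus)
    then have dc: "d * F * (c * E) = F * E"
      by (metis com(1) mult.assoc mult_1)
    have a: "(K * F * L - d * F) * (K * E * L) \<in> uq_ideal q"
      "d * F * (K * E * L - c * E) \<in> uq_ideal q"
      "K * F * (L * K - 1) * (E * L) \<in> uq_ideal q"
      "E * (L * K - 1) * F \<in> uq_ideal q"
      using R by (auto intro: uq_ideal_mult_left uq_ideal_mult_right)
    have "free_antipode r = (K * F * L - d * F) * (K * E * L) + d * F * (K * E * L - c * E)
        - K * F * (L * K - 1) * (E * L) - E * (L * K - 1) * F
        - (E * F - F * E - e * (K - L))"
      unfolding 5 simps right_diff_distrib dc by (simp add: algebra_simps com)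
    then show ?thesis using R(5) a by (metis uq_ideal_add uq_ideal_diff)
  qed
qed


lemma free_antipode_uq_ideal:
  assumes "q \<noteq> 0" "p \<in> uq_ideal q"
  shows "free_antipode p \<in> uq_ideal q"
proof -
  have "uq_ideal q \<subseteq> {p. free_antipode p \<in> uq_ideal q}"
    by (rule uq_ideal_least)
       (use assms(1) in \<open>auto simp: free_antipode_relator free_antipode_add free_antipode_mult
          intro: uq_ideal_zero uq_ideal_add uq_ideal_mult_left uq_ideal_mult_right\<close>)
  then show ?thesis using assms(2) by blast
qed

lemma antipode_uq_class:
  assumes "q \<noteq> 0"
  shows "antipode q (uq_class q p) = uq_class q (free_antipode p)"
  unfolding antipode_def uq_class_eq_iff free_antipode_diff[symmetric]
  using free_antipode_uq_ideal[OF assms some_in_uq_class] .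

lemma (in vector_space) trace_on_eq:
  assumes B: "independent B" "span B = H" "finite B"
    and T: "\<And>x. x \<in> H \<Longrightarrow> T x \<in> H" "\<And>x y. x \<in> H \<Longrightarrow> y \<in> H \<Longrightarrow> T (x + y) = T x + T y"
      "\<And>c x. x \<in> H \<Longrightarrow> T (c *s x) = c *s T x"
  shows "trace_on H T = (\<Sum>b\<in>B. representation B (T b) b)"
proof -
  define C where "C = (SOME B. independent B \<and> span B = H)"
  have C: "independent C" "span C = H"
    using someI[of "\<lambda>B. independent B \<and> span B = H" B] B by (auto simp: C_def)
  have "finite C"
    using B C by (metis independent_span_bound span_superset)
  have BH: "b \<in> B \<Longrightarrow> b \<in> H" and CH: "b \<in> C \<Longrightarrow> b \<in> H" for b
    using B C span_base by auto
  have H0: "0 \<in> H" using B span_zero by metis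
  have T0: "T 0 = 0" using T(2)[OF H0 H0] by simp
  have Hs: "sum f A \<in> H" if "\<And>a. a \<in> A \<Longrightarrow> f a \<in> H" for f :: "'b \<Rightarrow> 'b" and A
    using span_sum[of A f B] B(2) that by auto
  have Hc: "c *s x \<in> H" if "x \<in> H" for c x
    using span_scale[of x B c] B(2) that by auto
  have Tsum: "T (\<Sum>a\<in>A. r a *s a) = (\<Sum>a\<in>A. r a *s T a)" if "finite A" "A \<subseteq> H" for A r
    using that
    by (induction A rule: finite_induct) (auto simp: T0 T(2,3) Hs Hc subset_iff)
  have expand: "representation A (T y) x =
      (\<Sum>a\<in>A'. representation A' y a * representation A (T a) x)"
    if "independent A" "span A = H" "independent A'" "span A' = H" "finite A'" "y \<in> H" for A A' x y
  proof -
    have A'H: "A' \<subseteq> H" using that span_superset by blast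
    have "T y = T (\<Sum>a\<in>A'. representation A' y a *s a)"
      using sum_representation_eq[of A' y A'] that by simp
    also have "\<dots> = (\<Sum>a\<in>A'. representation A' y a *s T a)"
      using Tsum that(5) A'H .
    also have "representation A \<dots> x = (\<Sum>a\<in>A'. representation A (representation A' y a *s T a) x)"
      using A'H T(1) by (subst representation_sum) (auto simp: that Hc)
    also have "\<dots> = (\<Sum>a\<in>A'. representation A' y a * representation A (T a) x)"
      using A'H T(1) by (intro sum.cong refl) (subst representation_scale, auto simp: that)
    finally show ?thesis .
  qed
  have change: "representation C y c = (\<Sum>b\<in>B. representation B y b * representation C b c)"
    if "y \<in> H" for y c
  proof -
    have "representation C y c = representation C (\<Sum>b\<in>B. representation B y b *s b) c"
      using sum_representation_eq[of B y B] B that by simp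
    also have "\<dots> = (\<Sum>b\<in>B. representation C (representation B y b *s b) c)"
      using BH C by (subst representation_sum) (auto simp: Hc)
    also have "\<dots> = (\<Sum>b\<in>B. representation B y b * representation C b c)"
      using BH C by (intro sum.cong refl) (subst representation_scale, auto)
    finally show ?thesis .
  qed
  have "trace_on H T = (\<Sum>c\<in>C. representation C (T c) c)"
    by (simp add: trace_on_def C_def Let_def)
  also have "\<dots> = (\<Sum>c\<in>C. \<Sum>b\<in>B. representation B (T c) b * representation C b c)"
    using T(1) CH by (intro sum.cong refl change) auto
  also have "\<dots> = (\<Sum>b\<in>B. \<Sum>c\<in>C. representation C b c * representation B (T c) b)"
    by (subst sum.swap) (simp add: mult.commute)
  also have "\<dots> = (\<Sum>b\<in>B. representation B (T b) b)"
    using expand[OF B(1,2) C \<open>finite C\<close>] BH by (intro sum.cong refl) simp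
  finally show ?thesis .
qed


lemma fun_scale_apply [simp]: "fun_scale s c f x = s c (f x)"
  by (simp add: fun_scale_def)

lemma vector_space_fun_scale:
  assumes "vector_space s"
  shows "vector_space (fun_scale s)"
proof -
  interpret vector_space s by fact
  show ?thesis
    by unfold_locales (simp_all add: fun_eq_iff scale_right_distrib scale_left_distrib)
qed

lemma vector_space_mult: "vector_space ((*) :: 'k::field \<Rightarrow> 'k \<Rightarrow> 'k)"
  by unfold_locales (simp_all add: algebra_simps)

lemma I_set_image: "2 * l = of_nat N \<Longrightarrow> I_set l = (\<lambda>n::nat. - l + of_nat n) ` {..N}"
proof -
  assume N: "2 * l = of_nat N"
  have "- l + of_nat n \<le> l \<longleftrightarrow> n \<le> N" for n :: nat
  proof -
    have "- l + of_nat n \<le> l \<longleftrightarrow> (of_nat n :: rat) \<le> of_nat N" using N by linarith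
    then show ?thesis by simp
  qed
  then show ?thesis by (auto simp: I_set_def)
qed

lemma finite_I_set: "finite (I_set l)"
proof (rule finite_subset)
  show "I_set l \<subseteq> (\<lambda>n::nat. - l + of_nat n) ` {..nat \<lceil>2 * l\<rceil>}"
  proof
    fix i assume "i \<in> I_set l"
    then obtain n :: nat where n: "i = - l + of_nat n" "i \<le> l" by (auto simp: I_set_def)
    then have "(of_nat n :: rat) \<le> 2 * l" by simp
    then have "n \<le> nat \<lceil>2 * l\<rceil>" by linarith
    with n show "i \<in> (\<lambda>n::nat. - l + of_nat n) ` {..nat \<lceil>2 * l\<rceil>}" by auto
  qed
qed simp

lemma sum_fun_apply: "(\<Sum>i\<in>A. f i) x = (\<Sum>i\<in>A. f i x)" for f :: "'i \<Rightarrow> 'a \<Rightarrow> 'b::comm_monoid_add"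
  by (induction A rule: infinite_finite_induct) auto

lemma v_gen_add: "v_gen q l g (x + y) = v_gen q l g x + v_gen q l g y"
  by (simp add: v_gen_def fun_eq_iff sum_fun_apply algebra_simps sum.distrib)

lemma v_gen_scale: "v_gen q l g (fun_scale (*) c x) = fun_scale (*) c (v_gen q l g x)"
  by (simp add: v_gen_def fun_eq_iff sum_fun_apply algebra_simps sum_distrib_left)

lemma v_gen_K: "v_gen q l GK x j = (if j \<in> I_set l then q powi \<lfloor>2 * j\<rfloor> * x j else 0)"
  and v_gen_Ki: "v_gen q l GKi x j = (if j \<in> I_set l then q powi (- \<lfloor>2 * j\<rfloor>) * x j else 0)"
  and v_gen_E: "v_gen q l GE x j =
     (if j \<in> I_set l \<and> j - 1 \<in> I_set l then q_int q \<lfloor>l + j\<rfloor> * x (j - 1) else 0)"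
  and v_gen_F: "v_gen q l GF x j =
     (if j \<in> I_set l \<and> j + 1 \<in> I_set l then q_int q \<lfloor>l - j\<rfloor> * x (j + 1) else 0)"
proof -
  have *: "(\<Sum>i\<in>I_set l. if i = a then f i else 0) = (if a \<in> I_set l then f a else 0)"
    for a and f :: "rat \<Rightarrow> 'a"
    by (simp add: sum.delta' finite_I_set)
  have fl: "\<lfloor>l + (j - 1)\<rfloor> + 1 = \<lfloor>l + j\<rfloor>" "\<lfloor>l - (j + 1)\<rfloor> + 1 = \<lfloor>l - j\<rfloor>"
    by linarith+
  show "v_gen q l GK x j = (if j \<in> I_set l then q powi \<lfloor>2 * j\<rfloor> * x j else 0)"
    unfolding v_gen_def sum_fun_apply
    by (subst *[symmetric], rule sum.cong) (auto simp: v_basis_def)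
  show "v_gen q l GKi x j = (if j \<in> I_set l then q powi (- \<lfloor>2 * j\<rfloor>) * x j else 0)"
    unfolding v_gen_def sum_fun_apply
    by (subst *[symmetric], rule sum.cong) (auto simp: v_basis_def)
  show "v_gen q l GE x j =
     (if j \<in> I_set l \<and> j - 1 \<in> I_set l then q_int q \<lfloor>l + j\<rfloor> * x (j - 1) else 0)"
  proof -
    have "v_gen q l GE x j = (\<Sum>i\<in>I_set l. if i = j - 1 then
        (if j \<in> I_set l then q_int q \<lfloor>l + j\<rfloor> * x (j - 1) else 0) else 0)"
      unfolding v_gen_def sum_fun_apply by (rule sum.cong) (auto simp: v_basis_def fl)
    then show ?thesis unfolding * by simp
  qed
  show "v_gen q l GF x j =
     (if j \<in> I_set l \<and> j + 1 \<in> I_set l then q_int q \<lfloor>l - j\<rfloor> * x (j + 1) else 0)"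
  proof -
    have "v_gen q l GF x j = (\<Sum>i\<in>I_set l. if i = j + 1 then
        (if j \<in> I_set l then q_int q \<lfloor>l - j\<rfloor> * x (j + 1) else 0) else 0)"
      unfolding v_gen_def sum_fun_apply by (rule sum.cong) (auto simp: v_basis_def fl)
    then show ?thesis unfolding * by simp
  qed
qed

lemma foldr_v_gen_add: "foldr (v_gen q l) gs (x + y) = foldr (v_gen q l) gs x + foldr (v_gen q l) gs y"
  by (induction gs) (simp_all only: foldr.simps id_apply o_apply v_gen_add)

lemma foldr_v_gen_scale:
  "foldr (v_gen q l) gs (fun_scale (*) c x) = fun_scale (*) c (foldr (v_gen q l) gs x)"
  by (induction gs) (simp_all only: foldr.simps id_apply o_apply v_gen_scale)

lemma v_free_act_single:
  "v_free_act q l (Poly_Mapping.single w c) x = fun_scale (*) c (foldr (v_gen q l) (letters w) x)"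
  by (simp add: v_free_act_def fun_eq_iff)

lemma v_free_act_add: "v_free_act q l (p + r) x = v_free_act q l p x + v_free_act q l r x"
  unfolding v_free_act_def
  by (rule sum_keys_add) (simp_all add: fun_eq_iff algebra_simps)

lemma v_free_act_add_right: "v_free_act q l p (x + y) = v_free_act q l p x + v_free_act q l p y"
  by (simp add: v_free_act_def foldr_v_gen_add fun_eq_iff sum_fun_apply algebra_simps sum.distrib)

lemma v_free_act_scale_right:
  "v_free_act q l p (fun_scale (*) c x) = fun_scale (*) c (v_free_act q l p x)"
  by (simp add: v_free_act_def foldr_v_gen_scale fun_eq_iff sum_fun_apply algebra_simps
      sum_distrib_left)

lemma v_free_act_mult: "v_free_act q l (p * r) x = v_free_act q l p (v_free_act q l r x)"
proof (induction p rule: free_alg_induct)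
  case (single w c)
  show ?case
  proof (induction r rule: free_alg_induct)
    case (single w' c')
    show ?case
      unfolding mult_single v_free_act_single plus_uq_word_def foldr_v_gen_scale
      by (simp add: fun_eq_iff mult.assoc)
  qed (simp only: v_free_act_add v_free_act_add_right distrib_left)
qed (simp only: v_free_act_add distrib_right)

lemma v_free_act_const: "v_free_act q l (free_const c) x = fun_scale (*) c x"
  by (simp add: free_const_def v_free_act_single zero_uq_word_def)

lemma v_free_act_1 [simp]: "v_free_act q l 1 x = x"
  using v_free_act_const[of q l 1 x] by (simp add: fun_eq_iff)

lemma v_free_act_0 [simp]: "v_free_act q l 0 x = 0"
  by (simp add: v_free_act_def)

lemma v_free_act_diff: "v_free_act q l (p - r) x = v_free_act q l p x - v_free_act q l r x"
  using v_free_act_add[of q l "p - r" r x] by (simp add: eq_diff_eq)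

lemma v_free_act_gen: "v_free_act q l (free_gen g) x = v_gen q l g x"
  by (simp add: free_gen_def v_free_act_single fun_eq_iff)

lemma v_gen_closed: "j \<notin> I_set l \<Longrightarrow> v_gen q l g x j = 0"
  by (cases g) (simp_all add: v_gen_K v_gen_Ki v_gen_E v_gen_F)

lemma v_free_act_closed:
  assumes "x \<in> rep_space (v_rep q l)"
  shows "v_free_act q l p x \<in> rep_space (v_rep q l)"
proof (induction p rule: free_alg_induct)
  case (single w c)
  show ?case
    by (cases "letters w") (use assms in \<open>auto simp: v_rep_def v_free_act_single v_gen_closed\<close>)
qed (auto simp: v_free_act_add v_rep_def)

lemma v_free_act_relator:
  assumes "q \<noteq> 0" "q ^ 2 \<noteq> 1" "2 * l \<in> \<nat>" "x \<in> rep_space (v_rep q l)" "r \<in> uq_relators q"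
  shows "v_free_act q l r x = 0"
proof
  fix j
  obtain N where N: "2 * l = of_nat N" using assms(3) by (auto simp: Nats_def)
  have x0: "x j = 0" if "j \<notin> I_set l" for j using that assms(4) by (simp add: v_rep_def)
  have I: "j \<in> I_set l \<longleftrightarrow> (\<exists>n\<le>N. j = - l + of_nat n)" for j
    by (auto simp: I_set_image[OF N])
  note simps = v_free_act_diff v_free_act_mult v_free_act_gen v_free_act_const
  show "v_free_act q l r x j = 0 j"
  proof (cases "j \<in> I_set l")
    case False
    have "v_free_act q l r x \<in> rep_space (v_rep q l)"
      using v_free_act_closed[OF assms(4)] .
    with False show ?thesis by (simp add: v_rep_def)
  next
    case True
    then obtain n where n: "n \<le> N" "j = - l + of_nat n" using I by auto
    have fl: "\<lfloor>2 * j\<rfloor> = 2 * int n - int N"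
    proof -
      have "2 * j = of_int (2 * int n - int N)" using n N by (simp add: algebra_simps)
      then show ?thesis by (metis floor_of_int)
    qed
    have fl': "\<lfloor>2 * (j - 1)\<rfloor> = \<lfloor>2 * j\<rfloor> - 2" "\<lfloor>2 * (j + 1)\<rfloor> = \<lfloor>2 * j\<rfloor> + 2"
      by (simp_all add: right_diff_distrib distrib_left)
    have fE: "\<lfloor>l + j\<rfloor> = int n" "\<lfloor>l + (j + 1)\<rfloor> = int n + 1" using n by linarith+
    have fF: "\<lfloor>l - j\<rfloor> = int N - int n" "\<lfloor>l - (j - 1)\<rfloor> = int N - int n + 1"
    proof -
      have "l - j = of_int (int N - int n)" using n N by (simp add: algebra_simps)
      then show "\<lfloor>l - j\<rfloor> = int N - int n" by (metis floor_of_int)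
      then show "\<lfloor>l - (j - 1)\<rfloor> = int N - int n + 1" by linarith
    qed
    have up: "j + 1 \<in> I_set l \<longleftrightarrow> n \<noteq> N"
    proof -
      have "j + 1 \<in> I_set l \<longleftrightarrow> (\<exists>m\<le>N. (of_nat (Suc n) :: rat) = of_nat m)"
        unfolding I n by (auto simp: algebra_simps)
      also have "\<dots> \<longleftrightarrow> Suc n \<le> N" by (simp only: of_nat_eq_iff) auto
      also have "\<dots> \<longleftrightarrow> n \<noteq> N" using n(1) by auto
      finally show ?thesis .
    qed
    have down: "j - 1 \<in> I_set l \<longleftrightarrow> n \<noteq> 0"
    proof -
      have "j - 1 \<in> I_set l \<longleftrightarrow> (\<exists>m\<le>N. (of_nat n :: rat) = of_nat (Suc m))"
        unfolding I n by (auto simp: algebra_simps)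
      also have "\<dots> \<longleftrightarrow> n \<noteq> 0" using n(1)
        by (simp only: of_nat_eq_iff) (metis Suc_leD not0_implies_Suc nat.distinct(1))
      finally show ?thesis .
    qed
    have qq: "q - inverse q \<noteq> 0"
    proof
      assume "q - inverse q = 0"
      then have "q * q = 1" using \<open>q \<noteq> 0\<close> by (simp add: field_simps)
      then show False using assms(2) by (simp add: power2_eq_square)
    qed
    have q0: "q_int q 0 = 0" by (simp add: q_int_def)
    have id: "q_int q (int n) * q_int q (int N - int n + 1) - q_int q (int N - int n) * q_int q (int n + 1)
       = (q powi (2 * int n - int N) - q powi (- (2 * int n - int N))) / (q - inverse q)"
    proof -
      define a where "a = q powi (int n)"
      define b where "b = q powi (int N - int n)"
      have ab: "a \<noteq> 0" "b \<noteq> 0" using \<open>q \<noteq> 0\<close> by (auto simp: a_def b_def)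
      have pw: "q powi (int n) = a" "q powi (- int n) = inverse a"
        "q powi (int N - int n) = b" "q powi (- (int N - int n)) = inverse b"
        "q powi (int N - int n + 1) = b * q" "q powi (- (int N - int n + 1)) = inverse (b * q)"
        "q powi (int n + 1) = a * q" "q powi (- (int n + 1)) = inverse (a * q)"
        using \<open>q \<noteq> 0\<close> by (simp_all add: a_def b_def power_int_minus power_int_add
          del: minus_diff_eq minus_add_distrib)
      have e: "2 * int n - int N = int n - (int N - int n)" by simp
      have pw': "q powi (2 * int n - int N) = a * inverse b"
        unfolding e using \<open>q \<noteq> 0\<close>
        by (subst power_int_diff) (simp_all only: a_def b_def divide_inverse simp_thms)
      then have pw'': "q powi (- (2 * int n - int N)) = inverse a * b"
        unfolding power_int_minus by simp
      show ?thesis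
        unfolding q_int_def pw pw' pw'' using ab \<open>q \<noteq> 0\<close> qq
        by (simp add: divide_simps) (simp add: algebra_simps)
    qed
    have p2: "q powi (m + 2) = q powi m * q ^ 2" "q powi (m - 2) = q powi m / q ^ 2"
      "q powi (- m) = inverse (q powi m)" "q powi m \<noteq> 0" for m
      using \<open>q \<noteq> 0\<close> by (simp_all add: power_int_add power_int_diff power_int_minus)
    have p3: "q powi m * q powi (2 - m) = q ^ 2" "q powi m * q powi (- m - 2) = inverse (q ^ 2)" for m
      using \<open>q \<noteq> 0\<close> by (simp_all add: power_int_diff power_int_minus divide_inverse)
    consider (1) "r = free_gen GK * free_gen GKi - 1" | (2) "r = free_gen GKi * free_gen GK - 1"
      | (3) "r = free_gen GK * free_gen GE * free_gen GKi - free_const (q powi 2) * free_gen GE"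
      | (4) "r = free_gen GK * free_gen GF * free_gen GKi - free_const (q powi (-2)) * free_gen GF"
      | (5) "r = free_gen GE * free_gen GF - free_gen GF * free_gen GE
           - free_const (1 / (q - inverse q)) * (free_gen GK - free_gen GKi)"
      using assms(5) unfolding uq_relators_def Let_def by blast
    then show ?thesis
    proof cases
      case 1 then show ?thesis using True \<open>q \<noteq> 0\<close> by (simp add: simps v_gen_K v_gen_Ki p2(3))
    next
      case 2 then show ?thesis using True \<open>q \<noteq> 0\<close> by (simp add: simps v_gen_K v_gen_Ki p2(3))
    next
      case 3 then show ?thesis using True p2(4) \<open>q \<noteq> 0\<close>
        by (simp add: simps v_gen_K v_gen_Ki v_gen_E fl' p2(2,3) p3)
    next
      case 4 then show ?thesis using True p2(4) \<open>q \<noteq> 0\<close>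
        by (simp add: simps v_gen_K v_gen_Ki v_gen_F fl' p2(1,3) p3)
    next
      case 5
      have "v_free_act q l r x j =
        (q_int q (int n) * q_int q (int N - int n + 1)
          - q_int q (int N - int n) * q_int q (int n + 1)) * x j
        - 1 / (q - inverse q) * (q powi \<lfloor>2 * j\<rfloor> * x j - q powi (- \<lfloor>2 * j\<rfloor>) * x j)"
        using True q0 unfolding 5
        by (cases "n = 0"; cases "n = N")
           (simp_all add: simps v_gen_K v_gen_Ki v_gen_F v_gen_E up down fE fF,
            simp_all add: algebra_simps)
      also have "\<dots> = 0"
        unfolding id fl by (simp add: algebra_simps diff_divide_distrib)
      finally show ?thesis by simp
    qed
  qed
qed

lemma v_free_act_uq_ideal:
  assumes "q \<noteq> 0" "q ^ 2 \<noteq> 1" "2 * l \<in> \<nat>" "x \<in> rep_space (v_rep q l)" "p \<in> uq_ideal q"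
  shows "v_free_act q l p x = 0"
proof -
  have z: "v_free_act q l p 0 = 0" for p
    using v_free_act_add_right[of q l p 0 0] by simp
  have "uq_ideal q \<subseteq> {p. \<forall>x\<in>rep_space (v_rep q l). v_free_act q l p x = 0}"
  proof (rule uq_ideal_least)
    show "uq_relators q \<subseteq> {p. \<forall>x\<in>rep_space (v_rep q l). v_free_act q l p x = 0}"
      using assms(1-3) by (auto simp: v_free_act_relator)
  qed (auto simp only: mem_Collect_eq v_free_act_0 v_free_act_add v_free_act_mult z add_0
      intro: v_free_act_closed)
  then show ?thesis using assms(4,5) by blast
qed

lemma v_rep_act_uq_class:
  assumes "q \<noteq> 0" "q ^ 2 \<noteq> 1" "2 * l \<in> \<nat>" "x \<in> rep_space (v_rep q l)"
  shows "rep_act (v_rep q l) (uq_class q p) x = v_free_act q l p x"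
  using v_free_act_uq_ideal[OF assms some_in_uq_class[of q p]]
  by (simp add: v_rep_def v_free_act_diff)

lemma fd_uq_module_v_rep:
  assumes "q \<noteq> 0" "q ^ 2 \<noteq> 1" "2 * l \<in> \<nat>"
  shows "fd_uq_module q (v_rep q l)"
proof -
  have s: "rep_scale (v_rep q l) = fun_scale (*)" by (simp add: v_rep_def)
  interpret vector_space "rep_scale (v_rep q l)"
    unfolding s by (intro vector_space_fun_scale vector_space_mult)
  note act = v_rep_act_uq_class[OF assms]
  have sub: "subspace (rep_space (v_rep q l))"
    by (rule subspaceI) (auto simp: v_rep_def)
  show ?thesis
  proof
    show "subspace (rep_space (v_rep q l))" by (fact sub)
    have "span (v_basis l ` I_set l) = rep_space (v_rep q l)"
    proof
      show "span (v_basis l ` I_set l) \<subseteq> rep_space (v_rep q l)"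
        by (rule span_minimal[OF _ sub]) (auto simp: v_rep_def v_basis_def)
      show "rep_space (v_rep q l) \<subseteq> span (v_basis l ` I_set l)"
      proof
        fix x assume x: "x \<in> rep_space (v_rep q l)"
        have "x j = (\<Sum>i\<in>I_set l. rep_scale (v_rep q l) (x i) (v_basis l i)) j" for j
        proof -
          have "(\<Sum>i\<in>I_set l. rep_scale (v_rep q l) (x i) (v_basis l i)) j =
             (\<Sum>i\<in>I_set l. if i = j then x i else 0)"
            unfolding sum_fun_apply s by (intro sum.cong) (auto simp: v_basis_def)
          also have "\<dots> = x j"
            using x by (simp add: sum.delta' finite_I_set v_rep_def)
          finally show ?thesis by simp
        qed
        then have "x = (\<Sum>i\<in>I_set l. rep_scale (v_rep q l) (x i) (v_basis l i))" ..
        also have "\<dots> \<in> span (v_basis l ` I_set l)"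
          by (intro span_sum span_scale span_base) auto
        finally show "x \<in> span (v_basis l ` I_set l)" .
      qed
    qed
    then show "\<exists>B. finite B \<and> span B = rep_space (v_rep q l)"
      using finite_I_set by blast
  qed (auto simp: carrier_Uq act s v_free_act_closed v_free_act_add_right v_free_act_scale_right
      Uq_add_class Uq_mult_class v_free_act_add v_free_act_mult v_free_act_const
      subspace_add[OF sub] subspace_scale[OF sub, unfolded s])
qed

lemma uq_module_dual_rep:
  assumes "uq_module q M" "q \<noteq> 0"
  shows "uq_module q (dual_rep q M)"
proof -
  interpret uq_module q M by fact
  have s: "rep_scale (dual_rep q M) = fun_scale (*)" by (simp add: dual_rep_def)
  interpret D: vector_space "rep_scale (dual_rep q M)"
    unfolding s by (intro vector_space_fun_scale vector_space_mult)
  note S = antipode_uq_class[OF assms(2)]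
  have cl: "uq_class q p \<in> carrier (Uq q)" for p by (auto simp: carrier_Uq)
  have mem: "f \<in> rep_space (dual_rep q M) \<longleftrightarrow> (\<forall>x. x \<notin> rep_space M \<longrightarrow> f x = 0) \<and>
      (\<forall>x\<in>rep_space M. \<forall>y\<in>rep_space M. f (x + y) = f x + f y) \<and>
      (\<forall>c. \<forall>x\<in>rep_space M. f (rep_scale M c x) = c * f x)" for f
    by (auto simp: dual_rep_def linear_maps_def restrict0_def fun_eq_iff)
  have act: "rep_act (dual_rep q M) (uq_class q p) f =
      (\<lambda>v. if v \<in> rep_space M then f (rep_act M (uq_class q (free_antipode p)) v) else 0)" for p f
    unfolding dual_rep_def restrict0_def uq_rep.simps S ..
  have add_class: "rep_act M (uq_class q (a + b)) x =
      rep_act M (uq_class q a) x + rep_act M (uq_class q b) x"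
    and mult_class: "rep_act M (uq_class q (a * b)) x =
      rep_act M (uq_class q a) (rep_act M (uq_class q b) x)" if "x \<in> rep_space M" for a b x
    using act_add_left[OF cl[of a] cl[of b] that] act_mult[OF cl[of a] cl[of b] that]
    by (simp_all add: Uq_add_class Uq_mult_class)
  have V: "x \<in> rep_space M \<Longrightarrow> y \<in> rep_space M \<Longrightarrow> x + y \<in> rep_space M"
     "x \<in> rep_space M \<Longrightarrow> rep_scale M c x \<in> rep_space M" for x y c
    using subspace_space by (auto intro: subspace_add subspace_scale)
  show ?thesis
  proof
    show "D.subspace (rep_space (dual_rep q M))"
      by (rule D.subspaceI) (auto simp: mem s algebra_simps)
  next
    fix u f assume "u \<in> carrier (Uq q)" "f \<in> rep_space (dual_rep q M)"
    then show "rep_act (dual_rep q M) u f \<in> rep_space (dual_rep q M)"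
      unfolding mem carrier_Uq
      by (auto simp: act V act_closed cl act_add_right act_scale_right)
  next
    fix u w f assume "u \<in> carrier (Uq q)" "w \<in> carrier (Uq q)" "f \<in> rep_space (dual_rep q M)"
    then show "rep_act (dual_rep q M) (u \<oplus>\<^bsub>Uq q\<^esub> w) f =
        rep_act (dual_rep q M) u f + rep_act (dual_rep q M) w f"
      "rep_act (dual_rep q M) (u \<otimes>\<^bsub>Uq q\<^esub> w) f =
        rep_act (dual_rep q M) u (rep_act (dual_rep q M) w f)"
      unfolding mem carrier_Uq
      by (auto simp: fun_eq_iff act V act_closed cl Uq_add_class Uq_mult_class free_antipode_add
          free_antipode_mult add_class mult_class)
  qed (auto simp: carrier_Uq act fun_eq_iff mem s act_const)
qed

lemma v_rep_act_gen:
  assumes "q \<noteq> 0" "q ^ 2 \<noteq> 1" "2 * l \<in> \<nat>" "i \<in> I_set l"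
  shows "rep_act (v_rep q l) (uq_class q (free_gen g)) (v_basis l i) = v_gen_basis q l g i"
proof
  fix j
  have "v_basis l i \<in> rep_space (v_rep q l)"
    using assms(4) by (auto simp: v_rep_def v_basis_def)
  then have "rep_act (v_rep q l) (uq_class q (free_gen g)) (v_basis l i) j =
      v_gen q l g (v_basis l i) j"
    using v_rep_act_uq_class[OF assms(1-3)] v_free_act_gen by metis
  also have "\<dots> = (\<Sum>k\<in>I_set l. if k = i then v_gen_basis q l g k j else 0)"
    unfolding v_gen_def sum_fun_apply by (intro sum.cong) (auto simp: v_basis_def)
  also have "\<dots> = v_gen_basis q l g i j"
    using assms(4) by (simp add: sum.delta' finite_I_set)
  finally show "rep_act (v_rep q l) (uq_class q (free_gen g)) (v_basis l i) j =
      v_gen_basis q l g i j" .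
qed

end

theory Submission
  imports Defs
begin

text \<open>A homomorphism $f : V_\ell \to V_\ell^\vee$ is a bilinear form with
  $b(ux, y) = b(x, S(u)y)$. The action of $K$ forces $b(v_i, v_j) = 0$ unless $i + j = 0$, and the
  action of $E$ gives a first-order recursion for the remaining values $b(v_i, v_{-i})$, so the
  space of homomorphisms is a line. The map $f \mapsto f^\vee \circ j$ turns $b(x, y)$ into
  $b(y, Kx)$; on the solution of the recursion this is multiplication by $(-1)^{2\ell}$.\<close>

text \<open>On a line the trace is the eigenvalue. The assumption on \<open>T\<close> covers all
  multiples of \<open>f\<close> at once, so it also yields the additivity and homogeneity on the
  line that \<open>trace_on_eq\<close> asks for.\<close>

lemma (in vector_space) trace_on_span_singleton:
  assumes f: "f \<noteq> 0" and T: "\<And>c. T (c *s f) = (c * s) *s f"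
  shows "trace_on (span {f}) T = s"
proof -
  have ind: "independent {f}" using f by simp
  have sp: "\<exists>c. x = c *s f" if "x \<in> span {f}" for x
    using that by (auto simp: span_singleton)
  have "trace_on (span {f}) T = (\<Sum>b\<in>{f}. representation {f} (T b) b)"
  proof (rule trace_on_eq[OF ind refl])
    fix x y c assume "x \<in> span {f}"
    then obtain a where a: "x = a *s f" using sp by blast
    show "T x \<in> span {f}" unfolding a T by (auto simp: span_singleton)
    show "T (c *s x) = c *s T x" unfolding a by (simp only: scale_scale T mult.assoc)
    assume "y \<in> span {f}"
    then obtain b where b: "y = b *s f" using sp by blast
    show "T (x + y) = T x + T y"
      unfolding a b by (simp only: scale_left_distrib[symmetric] T distrib_right[symmetric])
  qed simp
  also have "\<dots> = representation {f} (s *s f) f"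
    using T[of 1] by simp
  also have "\<dots> = s"
    using ind by (simp add: representation_scale span_base representation_basis)
  finally show ?thesis .
qed

section \<open>The candidate invariant form\<close>

definition weight :: "rat \<Rightarrow> nat \<Rightarrow> rat" where
  "weight l n = - l + of_nat n"

definition q_fact :: "'k::field \<Rightarrow> nat \<Rightarrow> 'k" where
  "q_fact q n = (\<Prod>m<n. q_int q (int m + 1))"

lemma q_fact_Suc: "q_fact q (Suc n) = q_fact q n * q_int q (int n + 1)"
  by (simp add: q_fact_def)

text \<open>The recursion forced by equivariance under $E$ has the solution
  $(-1)^n q^{n(n+1-N)} \binom{N}{n}_q$; dividing it by $[N]_q!$ makes the symmetry under
  $n \mapsto N - n$ visible.\<close>

definition form_coeff :: "'k::field \<Rightarrow> nat \<Rightarrow> nat \<Rightarrow> 'k" where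
  "form_coeff q N n =
     (- 1) ^ n * q powi (int n * (int n + 1 - int N)) / (q_fact q n * q_fact q (N - n))"

text \<open>\<open>weight l (N - n)\<close> is \<open>- weight l n\<close> when \<open>2 * l = of_nat N\<close>.\<close>

definition inv_form :: "'k::field \<Rightarrow> rat \<Rightarrow> nat \<Rightarrow> (rat \<Rightarrow> 'k) \<Rightarrow> (rat \<Rightarrow> 'k) \<Rightarrow> 'k" where
  "inv_form q l N x y =
     (\<Sum>n\<le>N. form_coeff q N n * x (weight l n) * y (weight l (N - n)))"

text \<open>Both restrictions follow the convention of extension by zero: the outer one for the map
  itself, the inner one for its values in the dual space.\<close>

definition inv_hom :: "'k::field \<Rightarrow> rat \<Rightarrow> nat \<Rightarrow> (rat \<Rightarrow> 'k) \<Rightarrow> (rat \<Rightarrow> 'k) \<Rightarrow> 'k" where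
  "inv_hom q l N = (let V = rep_space (v_rep q l) in
     restrict0 V (\<lambda>x. restrict0 V (inv_form q l N x)))"

locale generic_v_rep =
  fixes q :: "'k::field" and l :: rat and N :: nat
  assumes q0: "q \<noteq> 0" and not_root: "\<And>n::nat. n > 0 \<Longrightarrow> q ^ n \<noteq> 1"
    and l: "2 * l = of_nat N"
begin

abbreviation V where "V \<equiv> rep_space (v_rep q l)"
abbreviation wt where "wt \<equiv> weight l"
abbreviation e :: "nat \<Rightarrow> rat \<Rightarrow> 'k" where "e n \<equiv> v_basis l (wt n)"

section \<open>Quantum integers and the coefficients of the form\<close>

lemma powi_eq_1_iff: "q powi m = 1 \<longleftrightarrow> m = 0"
proof
  assume *: "q powi m = 1"
  show "m = 0"
  proof (rule ccontr)
    assume "m \<noteq> 0"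
    then have "nat \<bar>m\<bar> > 0" by simp
    moreover have "q ^ nat \<bar>m\<bar> = 1"
      using * q0 by (auto simp: power_int_def abs_if power_inverse split: if_splits)
    ultimately show False using not_root by blast
  qed
qed simp

lemma q_sq: "q ^ 2 \<noteq> 1"
  using not_root by simp

lemma q_diff: "q - inverse q \<noteq> 0"
proof
  assume "q - inverse q = 0"
  then have "q ^ 2 = 1" using q0 by (simp add: field_simps power2_eq_square)
  with q_sq show False by simp
qed

text \<open>Vanishing means \<open>q powi (n + n) = 1\<close>. Hence quantum factorials are
  invertible and the recursion for the coefficients can be solved.\<close>

lemma q_int_eq_0_iff: "q_int q n = 0 \<longleftrightarrow> n = 0"
proof -
  have "q_int q n = 0 \<longleftrightarrow> q powi n = q powi (- n)" using q_diff by (simp add: q_int_def)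
  also have "\<dots> \<longleftrightarrow> q powi n * q powi n = 1"
    using q0 by (simp add: power_int_minus field_simps)
  also have "\<dots> \<longleftrightarrow> q powi (n + n) = 1"
    using q0 by (simp only: power_int_add[OF disjI1] simp_thms)
  finally show ?thesis by (simp add: powi_eq_1_iff)
qed

lemma q_fact_nonzero: "q_fact q n \<noteq> 0"
  by (simp add: q_fact_def q_int_eq_0_iff)

lemma form_coeff_nonzero: "form_coeff q N n \<noteq> 0"
  using q0 by (simp add: form_coeff_def q_fact_nonzero)

text \<open>The exponents of \<open>q\<close> at \<open>Suc n\<close> and \<open>n\<close> differ by
  \<open>2 * n + 2 - N\<close>, and the factorials contribute the two quantum integers. Equivariance
  under both \<open>E\<close> and \<open>F\<close> comes down to this relation.\<close>

lemma form_coeff_Suc: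
  assumes "n < N"
  shows "q_int q (int n + 1) * form_coeff q N (Suc n) =
    - (q powi (2 * int n + 2 - int N) * q_int q (int N - int n) * form_coeff q N n)"
proof -
  have f: "q_fact q (N - n) = q_fact q (N - Suc n) * q_int q (int N - int n)"
    using q_fact_Suc[of q "N - Suc n"] assms
    by (simp add: Suc_diff_Suc of_nat_diff add.commute algebra_simps)
  have "q powi (int (Suc n) * (int (Suc n) + 1 - int N)) =
      q powi (2 * int n + 2 - int N) * q powi (int n * (int n + 1 - int N))"
    using q0 by (subst power_int_add[symmetric]) (simp_all add: algebra_simps)
  moreover have "q_int q (int n + 1) \<noteq> 0" "q_int q (int N - int n) \<noteq> 0"
    using assms by (simp_all add: q_int_eq_0_iff)
  ultimately show ?thesis
    by (simp add: form_coeff_def f q_fact_Suc q_fact_nonzero field_simps)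
qed

text \<open>Under the reflection the two factorials trade places, the exponent of \<open>q\<close>
  changes by \<open>N - 2 * n\<close>, which the eigenvalue of \<open>K\<close> compensates, and the
  alternating sign leaves \<open>(- 1) ^ N\<close>. This is the source of the indicator.\<close>

lemma form_coeff_reflect:
  assumes "n \<le> N"
  shows "q powi (2 * int n - int N) * form_coeff q N (N - n) = (- 1) ^ N * form_coeff q N n"
proof -
  have "q powi (2 * int n - int N) * q powi (int (N - n) * (int (N - n) + 1 - int N)) =
      q powi (int n * (int n + 1 - int N))"
    using q0 assms by (subst power_int_add[symmetric]) (simp_all add: of_nat_diff algebra_simps)
  moreover have "(- 1 :: 'k) ^ (N - n) = (- 1) ^ N * (- 1) ^ n"
    using assms by (simp add: power_add[symmetric] minus_one_power_iff)
  ultimately show ?thesis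
    using assms by (simp add: form_coeff_def mult.commute mult.left_commute)
qed

section \<open>The generators in coordinates\<close>

lemma I_set_wt: "I_set l = wt ` {..N}"
  using I_set_image[OF l] by (simp add: weight_def)

lemma wt_in: "wt n \<in> I_set l \<longleftrightarrow> n \<le> N"
  by (auto simp: I_set_wt weight_def)

lemma wt_eq [simp]: "wt m = wt n \<longleftrightarrow> m = n"
  by (simp add: weight_def)

lemma wt_Suc: "wt (Suc n) = wt n + 1"
  by (simp add: weight_def)

lemma wt_floor: "\<lfloor>2 * wt n\<rfloor> = 2 * int n - int N"
proof -
  have "2 * wt n = of_int (2 * int n - int N)" using l by (simp add: weight_def algebra_simps)
  then show ?thesis by (metis floor_of_int)
qed

lemma wt_floors: "\<lfloor>l + wt n\<rfloor> = int n" "\<lfloor>l - wt n\<rfloor> = int N - int n"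
proof -
  show "\<lfloor>l + wt n\<rfloor> = int n" by (simp add: weight_def)
  have "l - wt n = of_int (int N - int n)" using l by (simp add: weight_def algebra_simps)
  then show "\<lfloor>l - wt n\<rfloor> = int N - int n" by (metis floor_of_int)
qed

text \<open>Coordinates move against basis vectors: \<open>E\<close> raises the basis, so the
  coordinate at \<open>n\<close> reads the one at \<open>n - 1\<close>, while for \<open>F\<close>
  it reads the one at \<open>n + 1\<close>. The zero cases are the two ends of the weight
  string.\<close>

lemma v_gen_wt:
  assumes "n \<le> N"
  shows "v_gen q l GK x (wt n) = q powi (2 * int n - int N) * x (wt n)"
    and "v_gen q l GKi x (wt n) = q powi (int N - 2 * int n) * x (wt n)"
    and "v_gen q l GE x (wt n) = (case n of 0 \<Rightarrow> 0 | Suc m \<Rightarrow> q_int q (int n) * x (wt m))"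
    and "v_gen q l GF x (wt n) = (if n = N then 0 else q_int q (int N - int n) * x (wt (Suc n)))"
proof -
  show "v_gen q l GK x (wt n) = q powi (2 * int n - int N) * x (wt n)"
    and "v_gen q l GKi x (wt n) = q powi (int N - 2 * int n) * x (wt n)"
    using assms by (simp_all add: v_gen_K v_gen_Ki wt_in wt_floor)
  have "wt 0 - 1 \<notin> I_set l" by (auto simp: I_set_wt weight_def)
  then show "v_gen q l GE x (wt n) = (case n of 0 \<Rightarrow> 0 | Suc m \<Rightarrow> q_int q (int n) * x (wt m))"
    using assms wt_floors(1)[of n] wt_Suc[of "n - 1"] wt_in[of n] wt_in[of "n - 1"]
    by (cases n) (auto simp: v_gen_E)
  show "v_gen q l GF x (wt n) = (if n = N then 0 else q_int q (int N - int n) * x (wt (Suc n)))"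
    using assms wt_in[of "Suc n"] by (auto simp: v_gen_F wt_in wt_floors wt_Suc)
qed

section \<open>Invariance of the form\<close>

lemma v_free_act_uminus: "v_free_act q l (- p) x = - v_free_act q l p x"
  using v_free_act_diff[of q l 0 p x] by simp

text \<open>For \<open>K\<close> and its inverse the sums agree term by term, because paired weights
  are opposite. For \<open>E\<close> and \<open>F\<close> each side loses one end term, and after an
  index shift \<open>form_coeff_Suc\<close> matches the rest.\<close>

lemma inv_form_gen:
  "inv_form q l N (v_gen q l g x) y = inv_form q l N x (v_free_act q l (free_antipode_gen g) y)"
proof (cases g)
  case GK
  then show ?thesis
    unfolding inv_form_def by (intro sum.cong) (auto simp: v_free_act_gen v_gen_wt of_nat_diff)
next
  case GKi
  then show ?thesis
    unfolding inv_form_def by (intro sum.cong) (auto simp: v_free_act_gen v_gen_wt of_nat_diff)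
next
  case GE
  have S: "v_free_act q l (free_antipode_gen g) y = - v_gen q l GE (v_gen q l GKi y)"
    by (simp add: GE v_free_act_uminus v_free_act_mult v_free_act_gen)
  show ?thesis
  proof (cases N)
    case 0
    then show ?thesis unfolding S by (simp add: inv_form_def GE v_gen_wt)
  next
    case (Suc M)
    \<comment> \<open>Vectors in the image of \<open>E\<close> have lowest coordinate zero, so the
      term at 0 drops out before the shift.\<close>
    have "inv_form q l N (v_gen q l g x) y =
        (\<Sum>n\<le>M. (q_int q (int n + 1) * form_coeff q N (Suc n)) * (x (wt n) * y (wt (M - n))))"
      unfolding inv_form_def GE
      by (simp add: Suc sum.atMost_Suc_shift v_gen_wt[unfolded Suc] ac_simps del: sum.atMost_Suc)
    also have "\<dots> = (\<Sum>n\<le>M. form_coeff q N n * x (wt n) *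
        (- v_gen q l GE (v_gen q l GKi y)) (wt (Suc (M - n))))"
    proof (intro sum.cong refl)
      fix n assume "n \<in> {..M}"
      then have n: "n < N" "Suc (M - n) \<le> N" "M - n \<le> N" by (auto simp: Suc)
      have "int N - 2 * int (M - n) = 2 * int n + 2 - int N"
        "int (Suc (M - n)) = int N - int n"
        using n by (simp_all add: Suc of_nat_diff)
      then have "(- v_gen q l GE (v_gen q l GKi y)) (wt (Suc (M - n))) =
          - (q_int q (int N - int n) * (q powi (2 * int n + 2 - int N) * y (wt (M - n))))"
        by (simp only: fun_Compl_def v_gen_wt[OF n(2)] v_gen_wt[OF n(3)] nat.case)
      then show "(q_int q (int n + 1) * form_coeff q N (Suc n)) * (x (wt n) * y (wt (M - n))) =
          form_coeff q N n * x (wt n) * (- v_gen q l GE (v_gen q l GKi y)) (wt (Suc (M - n)))"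
        unfolding form_coeff_Suc[OF n(1)] by (simp add: ac_simps)
    qed
    \<comment> \<open>The term at \<open>N\<close> that completes the sum pairs \<open>x\<close>
      with a lowest coordinate in the image of \<open>E\<close>, hence is zero.\<close>
    also have "\<dots> = inv_form q l N x (- v_gen q l GE (v_gen q l GKi y))"
      unfolding inv_form_def
      by (simp add: Suc v_gen_wt[unfolded Suc] Suc_diff_le)
    finally show ?thesis unfolding S .
  qed
next
  case GF
  have S: "v_free_act q l (free_antipode_gen g) y = - v_gen q l GK (v_gen q l GF y)"
    by (simp add: GF v_free_act_uminus v_free_act_mult v_free_act_gen)
  show ?thesis
  proof (cases N)
    case 0
    then show ?thesis unfolding S by (simp add: inv_form_def GF v_gen_wt)
  next
    case (Suc M)
    have "inv_form q l N (v_gen q l g x) y =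
        (\<Sum>n\<le>M. (q_int q (int N - int n) * form_coeff q N n) * (x (wt (Suc n)) * y (wt (N - n))))"
      unfolding inv_form_def GF
      by (simp add: Suc v_gen_wt[unfolded Suc] ac_simps)
    also have "\<dots> = (\<Sum>n\<le>M. form_coeff q N (Suc n) * x (wt (Suc n)) *
        (- v_gen q l GK (v_gen q l GF y)) (wt (M - n)))"
    proof (intro sum.cong refl)
      fix n assume "n \<in> {..M}"
      then have n: "n < N" "M - n \<le> N" "M - n \<noteq> N" "Suc (M - n) = N - n" by (auto simp: Suc)
      \<comment> \<open>The exponent is opposite to the one in \<open>form_coeff_Suc\<close>, so the
        two powers of \<open>q\<close> cancel below.\<close>
      have "2 * int (M - n) - int N = - (2 * int n + 2 - int N)"
        "int N - int (M - n) = int n + 1"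
        using n by (simp_all add: Suc of_nat_diff)
      then have "(- v_gen q l GK (v_gen q l GF y)) (wt (M - n)) =
          - (inverse (q powi (2 * int n + 2 - int N)) * (q_int q (int n + 1) * y (wt (N - n))))"
        by (simp only: fun_Compl_def v_gen_wt[OF n(2)] n(3,4) if_False power_int_minus)
      then have "form_coeff q N (Suc n) * x (wt (Suc n)) *
          (- v_gen q l GK (v_gen q l GF y)) (wt (M - n)) =
          - (inverse (q powi (2 * int n + 2 - int N)) *
            (q_int q (int n + 1) * form_coeff q N (Suc n)) * (x (wt (Suc n)) * y (wt (N - n))))"
        by (simp add: ac_simps)
      then show "(q_int q (int N - int n) * form_coeff q N n) * (x (wt (Suc n)) * y (wt (N - n))) =
          form_coeff q N (Suc n) * x (wt (Suc n)) *
          (- v_gen q l GK (v_gen q l GF y)) (wt (M - n))"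
        unfolding form_coeff_Suc[OF n(1)] using q0 by (simp add: ac_simps)
    qed
    \<comment> \<open>Here the added term is the one at 0; it reads the top coordinate of a vector
      in the image of \<open>F\<close>, scaled by \<open>K\<close>.\<close>
    also have "\<dots> = inv_form q l N x (- v_gen q l GK (v_gen q l GF y))"
      unfolding inv_form_def Suc sum.atMost_Suc_shift diff_Suc_Suc
      by (simp add: v_gen_wt(1)[unfolded Suc] v_gen_wt(4)[of "Suc M", unfolded Suc])
    finally show ?thesis unfolding S .
  qed
qed

text \<open>By additivity words suffice. Letters cross the form one at a time, the leftmost first,
  which produces the reversed order of the antipode; the second argument changes at each crossing,
  so it stays arbitrary in the induction.\<close>

lemma inv_form_act:
  "inv_form q l N (v_free_act q l p x) y = inv_form q l N x (v_free_act q l (free_antipode p) y)"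
proof -
  have add_l: "inv_form q l N (x + x') y = inv_form q l N x y + inv_form q l N x' y"
    and add_r: "inv_form q l N x (y + y') = inv_form q l N x y + inv_form q l N x y'"
    and scale_l: "inv_form q l N (fun_scale (*) c x) y = c * inv_form q l N x y"
    and scale_r: "inv_form q l N x (fun_scale (*) c y) = c * inv_form q l N x y" for x x' y y' c
    by (simp_all add: inv_form_def sum.distrib sum_distrib_left algebra_simps)
  show ?thesis
  proof (induction p rule: free_alg_induct)
    case (single w c)
    have "inv_form q l N (foldr (v_gen q l) gs x) y =
        inv_form q l N x (v_free_act q l (prod_list (rev (map free_antipode_gen gs))) y)" for gs
      by (induction gs arbitrary: y) (simp_all add: inv_form_gen v_free_act_mult)
    then show ?case
      by (simp only: v_free_act_single free_antipode_single v_free_act_mult v_free_act_const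
          scale_l scale_r)
  next
    case (add p r)
    then show ?case by (simp only: v_free_act_add free_antipode_add add_l add_r)
  qed
qed

section \<open>Homomorphisms to the dual as bilinear forms\<close>

lemma Nats_l: "2 * l \<in> \<nat>"
  by (simp add: l)

lemmas rep_act_class = v_rep_act_uq_class[OF q0 q_sq Nats_l]

lemma V_iff: "x \<in> V \<longleftrightarrow> (\<forall>i. i \<notin> I_set l \<longrightarrow> x i = 0)"
  by (simp add: v_rep_def)

lemma scale_v_rep: "rep_scale (v_rep q l) = fun_scale (*)"
  by (simp add: v_rep_def)

lemma V_closed: "x \<in> V \<Longrightarrow> y \<in> V \<Longrightarrow> x + y \<in> V" "x \<in> V \<Longrightarrow> fun_scale (*) c x \<in> V"
  by (simp_all add: V_iff)

lemma e_in: "e n \<in> V"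
  by (auto simp: V_iff v_basis_def)

lemma dual_space_iff:
  "g \<in> rep_space (dual_rep q (v_rep q l)) \<longleftrightarrow> (\<forall>x. x \<notin> V \<longrightarrow> g x = 0) \<and>
      (\<forall>x\<in>V. \<forall>y\<in>V. g (x + y) = g x + g y) \<and> (\<forall>c. \<forall>x\<in>V. g (fun_scale (*) c x) = c * g x)"
  by (auto simp: dual_rep_def linear_maps_def restrict0_def fun_eq_iff scale_v_rep)

lemma dual_act:
  "rep_act (dual_rep q (v_rep q l)) (uq_class q p) g =
     restrict0 V (\<lambda>v. g (v_free_act q l (free_antipode p) v))"
  by (auto simp: dual_rep_def restrict0_def antipode_uq_class[OF q0] rep_act_class fun_eq_iff)

text \<open>Uncurrying reduces everything to scalars \<open>f x y\<close> and to elements of the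
  free algebra, so that later arguments avoid quotient classes and chosen representatives.\<close>

lemma uq_hom_iff:
  "f \<in> uq_hom q (v_rep q l) (dual_rep q (v_rep q l)) \<longleftrightarrow>
     (\<forall>x. x \<notin> V \<longrightarrow> f x = 0) \<and> (\<forall>x y. y \<notin> V \<longrightarrow> f x y = 0) \<and>
     (\<forall>x\<in>V. \<forall>y\<in>V. \<forall>z\<in>V. f x (y + z) = f x y + f x z) \<and>
     (\<forall>x\<in>V. \<forall>y\<in>V. \<forall>c. f x (fun_scale (*) c y) = c * f x y) \<and>
     (\<forall>x\<in>V. \<forall>y\<in>V. \<forall>z\<in>V. f (x + y) z = f x z + f y z) \<and>
     (\<forall>x\<in>V. \<forall>y\<in>V. \<forall>c. f (fun_scale (*) c x) y = c * f x y) \<and>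
     (\<forall>p. \<forall>x\<in>V. \<forall>y\<in>V. f (v_free_act q l p x) y = f x (v_free_act q l (free_antipode p) y))"
  (is "_ \<longleftrightarrow> ?R")
proof
  assume f: "f \<in> uq_hom q (v_rep q l) (dual_rep q (v_rep q l))"
  have 1: "f x = 0" if "x \<notin> V" for x
  proof -
    have "f x = restrict0 V f x" using f by (simp add: uq_hom_def linear_maps_def)
    then show ?thesis using that by (simp add: restrict0_def)
  qed
  have 2: "f x \<in> rep_space (dual_rep q (v_rep q l))" if "x \<in> V" for x
    using f that by (auto simp: uq_hom_def linear_maps_def)
  have 3: "f (x + y) = f x + f y" if "x \<in> V" "y \<in> V" for x y
    using f that by (auto simp: uq_hom_def linear_maps_def)
  have 4: "f (fun_scale (*) c x) = fun_scale (*) c (f x)" if "x \<in> V" for c x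
    using f that by (auto simp: uq_hom_def linear_maps_def scale_v_rep dual_rep_def)
  have 5: "f (v_free_act q l p x) = restrict0 V (\<lambda>v. f x (v_free_act q l (free_antipode p) v))"
    if "x \<in> V" for p x
  proof -
    have "f (rep_act (v_rep q l) (uq_class q p) x) =
        rep_act (dual_rep q (v_rep q l)) (uq_class q p) (f x)"
      using f that by (auto simp: uq_hom_def carrier_Uq)
    then show ?thesis using that by (simp add: dual_act rep_act_class)
  qed
  have 6: "f x y = 0" if "y \<notin> V" for x y
    using 1[of x] 2[of x] that by (cases "x \<in> V") (auto simp: dual_space_iff)
  show ?R
    using 1 2 6 by (auto simp: 3 4 5 dual_space_iff) (auto simp: restrict0_def)
next
  assume R: ?R
  then have "rep_act (dual_rep q (v_rep q l)) (uq_class q p) (f x) = f (v_free_act q l p x)"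
    if "x \<in> V" for p x
    using that by (auto simp: dual_act restrict0_def fun_eq_iff)
  moreover have "f x \<in> rep_space (dual_rep q (v_rep q l))" for x
    using R by (cases "x \<in> V") (auto simp: dual_space_iff)
  moreover have "f (x + y) = f x + f y" if "x \<in> V" "y \<in> V" for x y
  proof
    show "f (x + y) z = (f x + f y) z" for z using R that by (cases "z \<in> V") auto
  qed
  moreover have "f (fun_scale (*) c x) = fun_scale (*) c (f x)" if "x \<in> V" for x c
  proof
    show "f (fun_scale (*) c x) z = fun_scale (*) c (f x) z" for z
      using R that by (cases "z \<in> V") auto
  qed
  moreover have "restrict0 V f = f"
    using R by (auto simp: restrict0_def fun_eq_iff)
  ultimately show "f \<in> uq_hom q (v_rep q l) (dual_rep q (v_rep q l))"
    by (auto simp: uq_hom_def linear_maps_def carrier_Uq rep_act_class scale_v_rep)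
       (simp add: dual_rep_def)
qed

lemma inv_hom_apply: "inv_hom q l N x y = (if x \<in> V \<and> y \<in> V then inv_form q l N x y else 0)"
  by (simp add: inv_hom_def restrict0_def Let_def)

text \<open>The scalar is carried along so that this gives at once the inclusion of the whole line
  in the space of homomorphisms.\<close>

lemma inv_hom_scale_in:
  "fun_scale (fun_scale (*)) c (inv_hom q l N) \<in> uq_hom q (v_rep q l) (dual_rep q (v_rep q l))"
  unfolding uq_hom_iff
  by (auto simp: inv_hom_apply V_closed v_free_act_closed inv_form_act fun_eq_iff)
     (auto simp: inv_form_def sum.distrib sum_distrib_left algebra_simps)

section \<open>The homomorphisms form a line\<close>

lemma v_basis_expansion: "x \<in> V \<Longrightarrow> x = (\<Sum>n\<le>N. fun_scale (*) (x (wt n)) (e n))"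
proof
  fix j assume x: "x \<in> V"
  show "x j = (\<Sum>n\<le>N. fun_scale (*) (x (wt n)) (e n)) j"
  proof (cases "j \<in> I_set l")
    case True
    then obtain m where m: "m \<le> N" "j = wt m" by (auto simp: I_set_wt)
    have "(\<Sum>n\<le>N. fun_scale (*) (x (wt n)) (e n)) j = (\<Sum>n\<le>N. if n = m then x (wt n) else 0)"
      unfolding sum_fun_apply m by (intro sum.cong) (auto simp: v_basis_def wt_in)
    then show ?thesis using m by simp
  next
    case False
    then show ?thesis using x
      by (auto simp: V_iff sum_fun_apply v_basis_def intro!: sum.neutral)
  qed
qed

text \<open>The case \<open>n = N\<close> fits the formula for \<open>E\<close> because
  \<open>e (Suc N)\<close> is zero by the convention in \<open>v_basis\<close>.\<close>

lemma v_gen_e: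
  assumes "n \<le> N"
  shows "v_gen q l GK (e n) = fun_scale (*) (q powi (2 * int n - int N)) (e n)"
    and "v_gen q l GKi (e n) = fun_scale (*) (q powi (int N - 2 * int n)) (e n)"
    and "v_gen q l GE (e n) = fun_scale (*) (q_int q (int n + 1)) (e (Suc n))"
proof -
  have g: "v_gen q l g (e n) = v_gen_basis q l g (wt n)" for g
    using v_rep_act_gen[OF q0 q_sq Nats_l, of "wt n" g] assms
    by (simp add: rep_act_class e_in v_free_act_gen wt_in)
  have "\<lfloor>l + wt n + 1\<rfloor> = int n + 1" using wt_floors(1)[of n] by linarith
  then show "v_gen q l GK (e n) = fun_scale (*) (q powi (2 * int n - int N)) (e n)"
    "v_gen q l GKi (e n) = fun_scale (*) (q powi (int N - 2 * int n)) (e n)"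
    "v_gen q l GE (e n) = fun_scale (*) (q_int q (int n + 1)) (e (Suc n))"
    unfolding g by (simp_all add: wt_floor wt_Suc)
qed

text \<open>A homomorphism is determined by its value at \<open>e 0\<close> and \<open>e N\<close>:
  all other basis values vanish by weight or follow from this one by a recursion with non-zero
  leading factor.\<close>

lemma uq_hom_multiple:
  assumes f: "f \<in> uq_hom q (v_rep q l) (dual_rep q (v_rep q l))"
  shows "\<exists>a. f = fun_scale (fun_scale (*)) a (inv_hom q l N)"
proof -
  note R = f[unfolded uq_hom_iff]
  have out: "f x = 0" if "x \<notin> V" for x using R that by blast
  have out': "f x y = 0" if "y \<notin> V" for x y using R that by blast
  have add_r: "f x (y + z) = f x y + f x z" if "x \<in> V" "y \<in> V" "z \<in> V" for x y z
    using R that by blast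
  have scale_r: "f x (fun_scale (*) c y) = c * f x y" if "x \<in> V" "y \<in> V" for x y c
    using R that by blast
  have add_l: "f (x + y) z = f x z + f y z" if "x \<in> V" "y \<in> V" "z \<in> V" for x y z
    using R that by blast
  have scale_l: "f (fun_scale (*) c x) y = c * f x y" if "x \<in> V" "y \<in> V" for x y c
    using R that by blast
  have equi: "f (v_gen q l g x) y = f x (v_free_act q l (free_antipode_gen g) y)"
    if "x \<in> V" "y \<in> V" for g x y
  proof -
    have "f (v_free_act q l (free_gen g) x) y =
        f x (v_free_act q l (free_antipode (free_gen g)) y)"
      using R that by blast
    then show ?thesis by (simp add: v_free_act_gen)
  qed
  have off: "f (e m) (e n) = 0" if "m \<le> N" "n \<le> N" "m + n \<noteq> N" for m n
  proof -
    \<comment> \<open>\<open>K\<close> on the left equals its inverse on the right; the two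
      eigenvalues agree only for \<open>m + n = N\<close>.\<close>
    have "q powi (2 * int m - int N) * f (e m) (e n) = q powi (int N - 2 * int n) * f (e m) (e n)"
      using equi[OF e_in e_in, of GK m n] that
      by (simp add: v_free_act_gen v_gen_e scale_l scale_r e_in)
    moreover have "q powi (2 * int m - int N) \<noteq> q powi (int N - 2 * int n)"
    proof
      assume "q powi (2 * int m - int N) = q powi (int N - 2 * int n)"
      then have "q powi ((2 * int m - int N) - (int N - 2 * int n)) = 1"
        using q0 by (subst power_int_diff) simp_all
      then show False using that unfolding powi_eq_1_iff by linarith
    qed
    ultimately show ?thesis by simp
  qed
  \<comment> \<open>The factor is read off at the pair where the recursion starts.\<close>
  define a where "a = f (e 0) (e N) / form_coeff q N 0"
  have diag: "f (e m) (e (N - m)) = a * form_coeff q N m" if "m \<le> N" for m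
    using that
  proof (induction m)
    case 0
    then show ?case by (simp add: a_def form_coeff_nonzero)
  next
    case (Suc m)
    have 1: "Suc (N - Suc m) = N - m" using Suc.prems by simp
    have uminus: "f x (- y) = - f x y" if "x \<in> V" "y \<in> V" for x y
      using scale_r[OF that, of "- 1"] by (simp add: fun_scale_def fun_Compl_def)
    \<comment> \<open>Equivariance under \<open>E\<close> at total index \<open>N - 1\<close>:
      raising the left vector gives the new diagonal value, raising the right one gives the previous
      value.\<close>
    have "q_int q (int m + 1) * f (e (Suc m)) (e (N - Suc m)) =
       - (q powi (2 * int m + 2 - int N) * q_int q (int N - int m) * f (e m) (e (N - m)))"
      using equi[OF e_in e_in, of GE m "N - Suc m"] Suc.prems
      by (simp add: v_free_act_uminus v_free_act_mult v_free_act_gen v_gen_e v_gen_scale 1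
          scale_l scale_r e_in uminus V_closed of_nat_diff algebra_simps)
    also have "\<dots> = a * (q_int q (int m + 1) * form_coeff q N (Suc m))"
      using Suc by (subst form_coeff_Suc) simp_all
    finally show ?case
      using q_int_eq_0_iff[of "int m + 1"] by (simp add: mult.left_commute)
  qed
  have sum_in: "(\<Sum>n\<in>A. fun_scale (*) (g n) (e n)) \<in> V" for g A
    by (induction A rule: infinite_finite_induct) (auto simp: V_iff v_basis_def)
  have sum_l: "f (\<Sum>n\<in>A. fun_scale (*) (g n) (e n)) y = (\<Sum>n\<in>A. g n * f (e n) y)"
    if "finite A" "y \<in> V" for A g y
    using that(1)
  proof (induction A rule: finite_induct)
    case empty
    show ?case using scale_l[OF e_in that(2), of 0 0] by (simp add: fun_scale_def zero_fun_def)
  next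
    case (insert n A)
    show ?case
      by (simp only: sum.insert[OF insert.hyps] add_l[OF V_closed(2)[OF e_in] sum_in that(2)]
          scale_l[OF e_in that(2)] insert.IH)
  qed
  have sum_r: "f x (\<Sum>n\<in>A. fun_scale (*) (g n) (e n)) = (\<Sum>n\<in>A. g n * f x (e n))"
    if "finite A" "x \<in> V" for A g x
    using that(1)
  proof (induction A rule: finite_induct)
    case empty
    show ?case using scale_r[OF that(2) e_in, of 0 0] by (simp add: fun_scale_def zero_fun_def)
  next
    case (insert n A)
    show ?case
      by (simp only: sum.insert[OF insert.hyps] add_r[OF that(2) V_closed(2)[OF e_in] sum_in]
          scale_r[OF that(2) e_in] insert.IH)
  qed
  have "f x y = a * inv_form q l N x y" if x: "x \<in> V" and y: "y \<in> V" for x y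
  proof -
    have "f x y = (\<Sum>m\<le>N. x (wt m) * f (e m) y)"
      by (subst v_basis_expansion[OF x]) (simp only: sum_l[OF _ y] finite_atMost)
    also have "\<dots> = (\<Sum>m\<le>N. x (wt m) * (\<Sum>n\<le>N. y (wt n) * f (e m) (e n)))"
      by (subst (1) v_basis_expansion[OF y]) (simp only: sum_r[OF _ e_in] finite_atMost)
    also have "\<dots> = (\<Sum>m\<le>N. x (wt m) * (y (wt (N - m)) * (a * form_coeff q N m)))"
    proof (intro sum.cong refl arg_cong2[where f = "(*)"])
      fix m assume "m \<in> {..N}"
      then have m: "m \<le> N" by simp
      have "(\<Sum>n\<le>N. y (wt n) * f (e m) (e n)) =
          (\<Sum>n\<le>N. if n = N - m then y (wt (N - m)) * (a * form_coeff q N m) else 0)"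
        using m off[OF m] diag[OF m] by (intro sum.cong) auto
      then show "(\<Sum>n\<le>N. y (wt n) * f (e m) (e n)) = y (wt (N - m)) * (a * form_coeff q N m)"
        by simp
    qed
    finally show ?thesis
      by (simp add: inv_form_def sum_distrib_left algebra_simps)
  qed
  then have "f = fun_scale (fun_scale (*)) a (inv_hom q l N)"
    by (auto simp: fun_eq_iff inv_hom_apply out out')
  then show ?thesis ..
qed

section \<open>The pivotal twist and the indicator\<close>

lemma inv_hom_nonzero: "inv_hom q l N \<noteq> 0"
proof
  assume "inv_hom q l N = 0"
  then have "inv_form q l N (e 0) (e N) = 0"
    using inv_hom_apply[of "e 0" "e N"] by (simp add: e_in)
  moreover have "inv_form q l N (e 0) (e N) = (\<Sum>n\<le>N. if n = 0 then form_coeff q N 0 else 0)"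
    unfolding inv_form_def by (intro sum.cong) (auto simp: v_basis_def wt_in)
  ultimately show False by (simp add: form_coeff_nonzero)
qed

text \<open>Exchanging the arguments reflects the summation index, and the eigenvalue of
  \<open>K\<close> is exactly the factor that \<open>form_coeff_reflect\<close> absorbs.\<close>

lemma inv_form_pivotal: "inv_form q l N y (v_gen q l GK x) = (- 1) ^ N * inv_form q l N x y"
proof -
  have "inv_form q l N y (v_gen q l GK x) = (\<Sum>n\<le>N. form_coeff q N (N - n) *
      y (wt (N - n)) * v_gen q l GK x (wt n))"
    unfolding inv_form_def
    by (rule sum.reindex_bij_witness[of _ "\<lambda>n. N - n" "\<lambda>n. N - n"]) auto
  also have "\<dots> = (\<Sum>n\<le>N. (- 1) ^ N * (form_coeff q N n * x (wt n) * y (wt (N - n))))"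
  proof (intro sum.cong refl)
    fix n assume "n \<in> {..N}"
    then have n: "n \<le> N" by simp
    have "form_coeff q N (N - n) * y (wt (N - n)) * v_gen q l GK x (wt n) =
       (q powi (2 * int n - int N) * form_coeff q N (N - n)) * (x (wt n) * y (wt (N - n)))"
      by (simp only: v_gen_wt[OF n] mult_ac)
    then show "form_coeff q N (N - n) * y (wt (N - n)) * v_gen q l GK x (wt n) =
        (- 1) ^ N * (form_coeff q N n * x (wt n) * y (wt (N - n)))"
      unfolding form_coeff_reflect[OF n] by (simp only: mult.assoc)
  qed
  finally show ?thesis by (simp add: inv_form_def sum_distrib_left)
qed

lemma fs_indicator_v_rep: "fs_indicator q (v_rep q l) = (- 1) ^ N"
proof -
  let ?s = "fun_scale (fun_scale (*)) :: 'k \<Rightarrow> ((rat \<Rightarrow> 'k) \<Rightarrow> (rat \<Rightarrow> 'k) \<Rightarrow> 'k) \<Rightarrow> _"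
  let ?H = "uq_hom q (v_rep q l) (dual_rep q (v_rep q l))"
  let ?T = "\<lambda>f. restrict0 V (transpose_map (v_rep q l) f \<circ> pivotal_map q (v_rep q l))"
  interpret H: vector_space ?s
    by (intro vector_space_fun_scale vector_space_mult)
  have H: "?H = H.span {inv_hom q l N}"
    unfolding H.span_singleton using inv_hom_scale_in uq_hom_multiple by blast
  have "?T (?s c (inv_hom q l N)) = ?s (c * (- 1) ^ N) (inv_hom q l N)" for c
  proof (intro ext)
    fix x y
    define f where "f = ?s c (inv_hom q l N)"
    have "f \<in> ?H" using inv_hom_scale_in by (simp add: f_def)
    \<comment> \<open>\<open>pivotal_map\<close> is cut off to zero outside the dual space, so it
      can be evaluated at \<open>f y\<close> only once \<open>f y\<close> is known to lie
      there.\<close>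
    then have "f z \<in> rep_space (dual_rep q (v_rep q l))" if "z \<in> V" for z
      using that by (auto simp: uq_hom_def linear_maps_def)
    then have "?T f x y = (if x \<in> V \<and> y \<in> V then f y (v_gen q l GK x) else 0)"
      by (simp add: restrict0_def transpose_map_def pivotal_map_def rep_act_class v_free_act_gen)
    moreover have "v_gen q l GK x \<in> V" by (simp add: V_iff v_gen_closed)
    ultimately show "?T f x y = ?s (c * (- 1) ^ N) (inv_hom q l N) x y"
      by (simp add: f_def inv_hom_apply inv_form_pivotal)
  qed
  then show ?thesis
    unfolding fs_indicator_def H
    using H.trace_on_span_singleton[OF inv_hom_nonzero, of ?T "(- 1) ^ N"]
    by (simp add: dual_rep_def)
qed

end

theorem theorem5p4:
  fixes q :: "'k::{alg_closed_field, field_char_0}"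
    and l :: rat
  assumes "q \<noteq> 0"
    and "\<forall>n::nat. n > 0 \<longrightarrow> q ^ n \<noteq> 1"
    and "2 * l \<in> \<nat>"
  shows "fs_indicator q (v_rep q l) = (- 1) powi \<lfloor>2 * l\<rfloor>"
proof -
  obtain N where N: "2 * l = of_nat N" using assms(3) by (auto simp: Nats_def)
  interpret generic_v_rep q l N
    using assms N by unfold_locales auto
  show ?thesis using fs_indicator_v_rep by (simp add: N)
qed

end
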